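(* Let $V,\Lambda,\mu_s,\mu_o>0$ be fixed. The feasible space of the hourly wage $w_s$ and the supply pool $K$ (pairs $(w_s,K)$ with $w_s,K>0$ and $V\ge\frac{w_s}{\mu_s}+2\sqrt{\frac{w_s}{\Lambda\mu_s}}$) can be divided into three regimes $\mathcal S,\mathcal O,\mathcal H$ such that the optimal service deployment for the service provider in the hybrid problem described in the context is: - Regime $\mathcal S$: to provide the standard service only, with employees, if $(w_s,K)\in\mathcal S$; - Regime $\mathcal O$: to provide the on-demand service only, with contractors, if $(w_s,K)\in\mathcal O$; - Regime $\mathcal H$: to provide two services, with both employees and contractors, if $(w_s,K)\in\mathcal H$.
   Context: Customers arrive according to a Poisson process with rate $\Lambda$ and have types $\theta$ uniform on $[0,1]$. Service $i\in\{s,o\}$ ($s$ = standard, $o$ = on-demand) with price $p_i$ and lead time $W_i$ gives a type-$\theta$ customer expected utility $U_i=V-p_i-\theta W_i$. Each customer joins the service with the highest nonnegative utility, and balks if both utilities are negative. The standard service is provided by employees, each with service rate $\mu_s$ and hourly wage $w_s$; the service provider chooses their number $k_s$. The on-demand service is provided by independent contractors, each with service rate $\mu_o$, drawn from a pool of $K$ potential contractors whose hourly reservation rates $r$ are uniform on $[0,1]$; the service provider chooses the per-service wage $w_o$, and the number $k_o$ of participating contractors is determined in equilibrium. Hybrid problem: the service provider solves $$\max_{p_s,p_o,k_s,w_o}\ p_s\lambda_s-w_sk_s+p_o\lambda_o-\lambda_ow_o$$ subject to $$\lambda_s=\Lambda\Pr(U_s\ge0,\,U_s\ge U_o),\qquad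 \lambda_o=\Lambda\Pr(U_o\ge0,\,U_o\ge U_s),$$ $$W_i=\frac{1}{k_i\mu_i-\lambda_i}\ (i\in\{s,o\}),\qquad k_o=K\Pr\!\left(\frac{\lambda_ow_o}{k_o}\ge r\right).$$ The service provider may also operate only one of the two services. Providing the standard service only means that the on-demand service is not operated ($\lambda_o=0$); providing the on-demand service only means that the standard service is not operated ($\lambda_s=0$); providing two services means that both are operated. *)

theory Defs
  imports "HOL-Probability.Probability"
begin

text \<open>Law of customer types and of contractors' hourly reservation rates.\<close>
definition unif01 :: "real measure" where
  "unif01 = uniform_measure lborel {0..1}"

definition utility :: "real \<Rightarrow> real \<Rightarrow> real \<Rightarrow> real \<Rightarrow> real" where
  "utility V p W \<theta> = V - p - \<theta> * W"

text \<open>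
  The provider's decisions are the two prices, the number of employees \<open>staff_s\<close> and the
  per-service wage \<open>wage_o\<close>; the other fields are the induced equilibrium quantities (arrival
  rates, lead times, number of participating contractors).  Staffing levels are real numbers.
\<close>
record plan =
  price_s :: real
  price_o :: real
  staff_s :: real
  wage_o  :: real
  rate_s  :: real
  rate_o  :: real
  lead_s  :: real
  lead_o  :: real
  staff_o :: real

text \<open>The formula for the lead time is meaningful only for a stable queue.\<close>
definition lead_time :: "real \<Rightarrow> real \<Rightarrow> real \<Rightarrow> real \<Rightarrow> bool" where
  "lead_time \<mu> k l W \<longleftrightarrow> l < k * \<mu> \<and> W = 1 / (k * \<mu> - l)"

definition participation :: "real \<Rightarrow> plan \<Rightarrow> bool" where
  "participation K x \<longleftrightarrow>
     staff_o x = K * measure unif01 {r. rate_o x * wage_o x / staff_o x \<ge> r}"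

definition profit :: "real \<Rightarrow> plan \<Rightarrow> real" where
  "profit w\<^sub>s x =
     price_s x * rate_s x - w\<^sub>s * staff_s x + price_o x * rate_o x - rate_o x * wage_o x"

datatype deployment = Standard_Only | On_Demand_Only | Two_Services

text \<open>
  A service is operated if it has a positive arrival rate.  A service that is not operated is not
  offered to the customers and has no staff; its price, wage and lead time are then irrelevant.

  When two services are operated, the last equation says that every joining customer joins
  exactly one service.  It follows from the equations for \<open>rate_s\<close> and \<open>rate_o\<close> unless the two
  offers coincide in price and lead time; in that case alone ties have positive probability, and
  those two equations would count (and charge) every joining customer twice.
\<close>
fun feasible ::
  "real \<Rightarrow> real \<Rightarrow> real \<Rightarrow> real \<Rightarrow> real \<Rightarrow> deployment \<Rightarrow> plan \<Rightarrow> bool" where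
  "feasible V \<Lambda> \<mu>\<^sub>s \<mu>\<^sub>o K Standard_Only x \<longleftrightarrow>
     rate_s x > 0 \<and> rate_o x = 0 \<and> staff_o x = 0 \<and>
     rate_s x = \<Lambda> * measure unif01 {\<theta>. utility V (price_s x) (lead_s x) \<theta> \<ge> 0} \<and>
     lead_time \<mu>\<^sub>s (staff_s x) (rate_s x) (lead_s x)"
| "feasible V \<Lambda> \<mu>\<^sub>s \<mu>\<^sub>o K On_Demand_Only x \<longleftrightarrow>
     rate_o x > 0 \<and> rate_s x = 0 \<and> staff_s x = 0 \<and>
     rate_o x = \<Lambda> * measure unif01 {\<theta>. utility V (price_o x) (lead_o x) \<theta> \<ge> 0} \<and>
     lead_time \<mu>\<^sub>o (staff_o x) (rate_o x) (lead_o x) \<and>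
     participation K x"
| "feasible V \<Lambda> \<mu>\<^sub>s \<mu>\<^sub>o K Two_Services x \<longleftrightarrow>
     rate_s x > 0 \<and> rate_o x > 0 \<and>
     (let U\<^sub>s = utility V (price_s x) (lead_s x); U\<^sub>o = utility V (price_o x) (lead_o x) in
       rate_s x = \<Lambda> * measure unif01 {\<theta>. U\<^sub>s \<theta> \<ge> 0 \<and> U\<^sub>s \<theta> \<ge> U\<^sub>o \<theta>} \<and>
       rate_o x = \<Lambda> * measure unif01 {\<theta>. U\<^sub>o \<theta> \<ge> 0 \<and> U\<^sub>o \<theta> \<ge> U\<^sub>s \<theta>} \<and>
       rate_s x + rate_o x = \<Lambda> * measure unif01 {\<theta>. U\<^sub>s \<theta> \<ge> 0 \<or> U\<^sub>o \<theta> \<ge> 0}) \<and>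
     lead_time \<mu>\<^sub>s (staff_s x) (rate_s x) (lead_s x) \<and>
     lead_time \<mu>\<^sub>o (staff_o x) (rate_o x) (lead_o x) \<and>
     participation K x"

text \<open>Some plan of the given deployment maximizes the profit over all plans of all deployments.\<close>
definition optimal_deployment ::
  "real \<Rightarrow> real \<Rightarrow> real \<Rightarrow> real \<Rightarrow> real \<Rightarrow> real \<Rightarrow> deployment \<Rightarrow> bool" where
  "optimal_deployment V \<Lambda> \<mu>\<^sub>s \<mu>\<^sub>o w\<^sub>s K d \<longleftrightarrow>
     (\<exists>x. feasible V \<Lambda> \<mu>\<^sub>s \<mu>\<^sub>o K d x \<and>
        (\<forall>d' y. feasible V \<Lambda> \<mu>\<^sub>s \<mu>\<^sub>o K d' y \<longrightarrow> profit w\<^sub>s y \<le> profit w\<^sub>s x))"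

definition feasible_space :: "real \<Rightarrow> real \<Rightarrow> real \<Rightarrow> (real \<times> real) set" where
  "feasible_space V \<Lambda> \<mu>\<^sub>s =
     {(w\<^sub>s, K). w\<^sub>s > 0 \<and> K > 0 \<and> V \<ge> w\<^sub>s / \<mu>\<^sub>s + 2 * sqrt (w\<^sub>s / (\<Lambda> * \<mu>\<^sub>s))}"

end

theory Submission
  imports Defs
begin

text \<open>
  It suffices that for every \<open>(w\<^sub>s, K)\<close> the profit attains its maximum over all plans of all
  deployments.  For given arrival rates and contractors, the profit is bounded by one of two
  expressions, according to which service is slower, and in each of them the optimal number of
  employees is found by completing a square.  The standard service alone then earns at most
  \<open>\<Lambda> (V - w\<^sub>s / \<mu>\<^sub>s - 2 sqrt (w\<^sub>s / (\<Lambda> \<mu>\<^sub>s)))\<close>, with equality when it serves everybody.  If this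
  value can be exceeded, the larger of the two expressions is maximal at some point by compactness.
  A maximum with \<open>l\<^sub>s = 0\<close> is an on-demand plan.  A maximum with \<open>l\<^sub>s > 0\<close> is a plan with two services:
  if the lead times were in the wrong order, or equal (when no split of the customers is feasible),
  then passing to the other expression would lose nothing and leave a suboptimal number of
  employees, contradicting maximality.
\<close>

section \<open>Demand for a single service\<close>

lemma measure_unif01:
  assumes "A \<in> sets borel"
  shows "measure unif01 A = measure lborel ({0..1} \<inter> A)"
  unfolding unif01_def using assms by (subst measure_uniform_measure) auto

lemma measure_unif01_Icc: "measure unif01 {u..v} = max 0 (min 1 v - max 0 u)"
  by (simp add: measure_unif01 Int_atLeastAtMost max_def min_def)

lemma measure_unif01_atMost: "measure unif01 {..v} = max 0 (min 1 v)"
proof -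
  have "{0..1} \<inter> {..v} = {0..min 1 v}" by auto
  then show ?thesis by (simp add: measure_unif01 max_def min_def)
qed

lemma utility_nonneg_set:
  assumes "W > 0"
  shows "{\<theta>. utility V p W \<theta> \<ge> 0} = {..(V - p) / W}"
  using assms by (auto simp: utility_def field_simps)

text \<open>Exactly the types up to \<open>(V - p) / W\<close> join, so the last type served,
  \<open>r / \<Lambda>\<close>, still has nonnegative utility and the price is at most
  \<open>V - r / \<Lambda> * W\<close>. Equality can fail only when everybody is served.\<close>

lemma single_demand_bound:
  assumes "\<Lambda> > 0" "W > 0" "r > 0"
    and r: "r = \<Lambda> * measure unif01 {\<theta>. utility V p W \<theta> \<ge> 0}"
  shows "r \<le> \<Lambda>" "p * r \<le> r * V - r\<^sup>2 * W / \<Lambda>"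
proof -
  define b where "b = (V - p) / W"
  have r': "r = \<Lambda> * max 0 (min 1 b)"
    using r by (simp add: utility_nonneg_set[OF assms(2)] measure_unif01_atMost b_def)
  have "b > 0" using assms(1,3) unfolding r' by (auto simp: zero_less_mult_iff max_def min_def split: if_splits)
  then have r2: "r / \<Lambda> = min 1 b" using r' assms by simp
  then have "r / \<Lambda> \<le> 1" "r / \<Lambda> \<le> b" by linarith+
  then show "r \<le> \<Lambda>" using assms by simp
  have "p \<le> V - r / \<Lambda> * W" using \<open>r / \<Lambda> \<le> b\<close> assms
    unfolding b_def by (simp add: pos_le_divide_eq algebra_simps)
  then have "p * r \<le> (V - r / \<Lambda> * W) * r" using assms by (intro mult_right_mono) auto
  then show "p * r \<le> r * V - r\<^sup>2 * W / \<Lambda>"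
    by (simp add: algebra_simps power2_eq_square)
qed

text \<open>This price leaves type \<open>r / \<Lambda>\<close> indifferent between joining and
  balking, so the revenue bound becomes tight.\<close>

lemma single_demand_attained:
  assumes "\<Lambda> > 0" "W > 0" "r > 0" "r \<le> \<Lambda>" and p: "p = V - r / \<Lambda> * W"
  shows "r = \<Lambda> * measure unif01 {\<theta>. utility V p W \<theta> \<ge> 0}"
    and "p * r = r * V - r\<^sup>2 * W / \<Lambda>"
  using assms by (auto simp: utility_nonneg_set measure_unif01_atMost algebra_simps power2_eq_square)

section \<open>Demand split between two services; index 1 is the slower one, index 2 the faster
  one\<close>

lemma slow_demand_set:
  assumes "0 < W\<^sub>2" "W\<^sub>2 < W\<^sub>1"
  shows "{\<theta>. utility V p\<^sub>1 W\<^sub>1 \<theta> \<ge> 0 \<and> utility V p\<^sub>1 W\<^sub>1 \<theta> \<ge> utility V p\<^sub>2 W\<^sub>2 \<theta>}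
    = {..min ((V - p\<^sub>1) / W\<^sub>1) ((p\<^sub>2 - p\<^sub>1) / (W\<^sub>1 - W\<^sub>2))}"
proof -
  have "W\<^sub>1 - W\<^sub>2 > 0" "W\<^sub>1 > 0" using assms by auto
  then show ?thesis
    by (auto simp: utility_def pos_le_divide_eq algebra_simps)
qed

lemma fast_demand_set:
  assumes "0 < W\<^sub>2" "W\<^sub>2 < W\<^sub>1"
  shows "{\<theta>. utility V p\<^sub>2 W\<^sub>2 \<theta> \<ge> 0 \<and> utility V p\<^sub>2 W\<^sub>2 \<theta> \<ge> utility V p\<^sub>1 W\<^sub>1 \<theta>}
    = {(p\<^sub>2 - p\<^sub>1) / (W\<^sub>1 - W\<^sub>2)..(V - p\<^sub>2) / W\<^sub>2}"
proof -
  have "W\<^sub>1 - W\<^sub>2 > 0" "W\<^sub>2 > 0" using assms by auto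
  then show ?thesis
    by (auto simp: utility_def pos_le_divide_eq pos_divide_le_eq algebra_simps)
qed

text \<open>The slow service takes the types up to \<open>a\<close>, the fast one those from
  \<open>a\<close> to \<open>min 1 b\<close>. Revenue is counted as if everybody paid
  \<open>p\<^sub>2\<close>, minus the discount \<open>a * (W\<^sub>1 - W\<^sub>2)\<close> for the
  slow service; \<open>p\<^sub>2\<close> is limited by the utility of the last type served.\<close>

lemma split_demand_bound:
  assumes "\<Lambda> > 0" and W: "0 < W\<^sub>2" "W\<^sub>2 < W\<^sub>1" and pos: "r\<^sub>1 > 0" "r\<^sub>2 > 0"
    and r1: "r\<^sub>1 = \<Lambda> * measure unif01
      {\<theta>. utility V p\<^sub>1 W\<^sub>1 \<theta> \<ge> 0 \<and> utility V p\<^sub>1 W\<^sub>1 \<theta> \<ge> utility V p\<^sub>2 W\<^sub>2 \<theta>}"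
    and r2: "r\<^sub>2 = \<Lambda> * measure unif01
      {\<theta>. utility V p\<^sub>2 W\<^sub>2 \<theta> \<ge> 0 \<and> utility V p\<^sub>2 W\<^sub>2 \<theta> \<ge> utility V p\<^sub>1 W\<^sub>1 \<theta>}"
  shows "r\<^sub>1 + r\<^sub>2 \<le> \<Lambda>"
    and "p\<^sub>1 * r\<^sub>1 + p\<^sub>2 * r\<^sub>2
      \<le> (r\<^sub>1 + r\<^sub>2) * V - (r\<^sub>1\<^sup>2 * W\<^sub>1 + ((r\<^sub>1 + r\<^sub>2)\<^sup>2 - r\<^sub>1\<^sup>2) * W\<^sub>2) / \<Lambda>"
proof -
  define a where "a = (p\<^sub>2 - p\<^sub>1) / (W\<^sub>1 - W\<^sub>2)"
  define b where "b = (V - p\<^sub>2) / W\<^sub>2"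
  define c where "c = (V - p\<^sub>1) / W\<^sub>1"
  have r1': "r\<^sub>1 = \<Lambda> * max 0 (min 1 (min c a))"
    using r1 by (simp add: slow_demand_set[OF W] measure_unif01_atMost a_def c_def)
  have r2': "r\<^sub>2 = \<Lambda> * max 0 (min 1 b - max 0 a)"
    using r2 by (simp add: fast_demand_set[OF W] measure_unif01_Icc a_def b_def)
  have "a > 0" using pos(1) assms(1) unfolding r1'
    by (auto simp: zero_less_mult_iff max_def min_def split: if_splits)
  have ab: "a < min 1 b" using pos(2) assms(1) unfolding r2'
    by (auto simp: zero_less_mult_iff max_def split: if_splits)
  have p1: "p\<^sub>1 = p\<^sub>2 - a * (W\<^sub>1 - W\<^sub>2)" and p2: "p\<^sub>2 = V - b * W\<^sub>2"
    using W by (auto simp: a_def b_def)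
  \<comment> \<open>Type \<open>a\<close> is indifferent between the services and lies below
    \<open>b\<close>, so it does not balk; the balking threshold \<open>c\<close> of the slow
    service therefore does not bind.\<close>
  have "a * W\<^sub>2 \<le> b * W\<^sub>2" using ab W by (intro mult_right_mono) auto
  moreover have "V - p\<^sub>1 = a * W\<^sub>1 + (b * W\<^sub>2 - a * W\<^sub>2)" unfolding p1 p2 by (simp add: algebra_simps)
  ultimately have "c \<ge> a" unfolding c_def using W by (subst pos_le_divide_eq) linarith+
  then have "max 0 (min 1 (min c a)) = a" using \<open>a > 0\<close> ab by linarith
  then have ra: "r\<^sub>1 = \<Lambda> * a" using r1' by (simp only:)
  have rb: "r\<^sub>1 + r\<^sub>2 = \<Lambda> * min 1 b" using ra r2' \<open>a > 0\<close> ab by (simp add: max_def algebra_simps)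
  show "r\<^sub>1 + r\<^sub>2 \<le> \<Lambda>" unfolding rb using assms(1) by (simp add: min_def)
  have "min 1 b * W\<^sub>2 \<le> b * W\<^sub>2" using W by (intro mult_right_mono) auto
  then have "p\<^sub>2 \<le> V - min 1 b * W\<^sub>2" using p2 by simp
  then have "p\<^sub>2 * (\<Lambda> * min 1 b) \<le> (V - min 1 b * W\<^sub>2) * (\<Lambda> * min 1 b)"
    using assms(1) ab \<open>a > 0\<close> by (intro mult_right_mono) auto
  moreover have "p\<^sub>1 * r\<^sub>1 + p\<^sub>2 * r\<^sub>2 = p\<^sub>2 * (r\<^sub>1 + r\<^sub>2) - \<Lambda> * a\<^sup>2 * (W\<^sub>1 - W\<^sub>2)"
    unfolding p1 ra by (simp add: algebra_simps power2_eq_square)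
  moreover have "(r\<^sub>1 + r\<^sub>2) * V - (r\<^sub>1\<^sup>2 * W\<^sub>1 + ((r\<^sub>1 + r\<^sub>2)\<^sup>2 - r\<^sub>1\<^sup>2) * W\<^sub>2) / \<Lambda>
      = (V - min 1 b * W\<^sub>2) * (\<Lambda> * min 1 b) - \<Lambda> * a\<^sup>2 * (W\<^sub>1 - W\<^sub>2)"
    unfolding rb unfolding ra using assms(1) by (simp add: field_simps power2_eq_square)
  ultimately show "p\<^sub>1 * r\<^sub>1 + p\<^sub>2 * r\<^sub>2
      \<le> (r\<^sub>1 + r\<^sub>2) * V - (r\<^sub>1\<^sup>2 * W\<^sub>1 + ((r\<^sub>1 + r\<^sub>2)\<^sup>2 - r\<^sub>1\<^sup>2) * W\<^sub>2) / \<Lambda>"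
    unfolding rb by linarith
qed

text \<open>The prices leave type \<open>(r\<^sub>1 + r\<^sub>2) / \<Lambda>\<close> indifferent
  between the fast service and balking, and type \<open>r\<^sub>1 / \<Lambda>\<close> indifferent
  between the two services.\<close>

lemma split_demand_attained:
  assumes "\<Lambda> > 0" and W: "0 < W\<^sub>2" "W\<^sub>2 < W\<^sub>1" and pos: "r\<^sub>1 > 0" "r\<^sub>2 > 0" and "r\<^sub>1 + r\<^sub>2 \<le> \<Lambda>"
    and p2: "p\<^sub>2 = V - (r\<^sub>1 + r\<^sub>2) / \<Lambda> * W\<^sub>2" and p1: "p\<^sub>1 = p\<^sub>2 - r\<^sub>1 / \<Lambda> * (W\<^sub>1 - W\<^sub>2)"
  shows "r\<^sub>1 = \<Lambda> * measure unif01
      {\<theta>. utility V p\<^sub>1 W\<^sub>1 \<theta> \<ge> 0 \<and> utility V p\<^sub>1 W\<^sub>1 \<theta> \<ge> utility V p\<^sub>2 W\<^sub>2 \<theta>}"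
    and "r\<^sub>2 = \<Lambda> * measure unif01
      {\<theta>. utility V p\<^sub>2 W\<^sub>2 \<theta> \<ge> 0 \<and> utility V p\<^sub>2 W\<^sub>2 \<theta> \<ge> utility V p\<^sub>1 W\<^sub>1 \<theta>}"
    and "r\<^sub>1 + r\<^sub>2 = \<Lambda> * measure unif01
      {\<theta>. utility V p\<^sub>1 W\<^sub>1 \<theta> \<ge> 0 \<or> utility V p\<^sub>2 W\<^sub>2 \<theta> \<ge> 0}"
    and "p\<^sub>1 * r\<^sub>1 + p\<^sub>2 * r\<^sub>2
      = (r\<^sub>1 + r\<^sub>2) * V - (r\<^sub>1\<^sup>2 * W\<^sub>1 + ((r\<^sub>1 + r\<^sub>2)\<^sup>2 - r\<^sub>1\<^sup>2) * W\<^sub>2) / \<Lambda>"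
proof -
  define a where "a = r\<^sub>1 / \<Lambda>"
  define b where "b = (r\<^sub>1 + r\<^sub>2) / \<Lambda>"
  have r: "r\<^sub>1 = \<Lambda> * a" "r\<^sub>2 = \<Lambda> * (b - a)" using assms(1) by (auto simp: a_def b_def field_simps)
  have ab: "0 < a" "a < b" "b \<le> 1" using assms by (auto simp: a_def b_def field_simps)
  have p2': "p\<^sub>2 = V - b * W\<^sub>2" and p1': "p\<^sub>1 = p\<^sub>2 - a * (W\<^sub>1 - W\<^sub>2)"
    using p1 p2 by (auto simp: a_def b_def)
  have a': "(p\<^sub>2 - p\<^sub>1) / (W\<^sub>1 - W\<^sub>2) = a" and b': "(V - p\<^sub>2) / W\<^sub>2 = b"
    using W p2' p1' by auto
  have "a * W\<^sub>2 \<le> b * W\<^sub>2" using ab W by (intro mult_right_mono) auto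
  moreover have "V - p\<^sub>1 = a * W\<^sub>1 + (b * W\<^sub>2 - a * W\<^sub>2)" unfolding p1' p2' by (simp add: algebra_simps)
  ultimately have c': "(V - p\<^sub>1) / W\<^sub>1 \<ge> a" using W by (subst pos_le_divide_eq) linarith+
  show "r\<^sub>1 = \<Lambda> * measure unif01
      {\<theta>. utility V p\<^sub>1 W\<^sub>1 \<theta> \<ge> 0 \<and> utility V p\<^sub>1 W\<^sub>1 \<theta> \<ge> utility V p\<^sub>2 W\<^sub>2 \<theta>}"
    using c' ab by (simp add: slow_demand_set[OF W] measure_unif01_atMost a' min_absorb2 r)
  show "r\<^sub>2 = \<Lambda> * measure unif01
      {\<theta>. utility V p\<^sub>2 W\<^sub>2 \<theta> \<ge> 0 \<and> utility V p\<^sub>2 W\<^sub>2 \<theta> \<ge> utility V p\<^sub>1 W\<^sub>1 \<theta>}"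
    using ab by (simp add: fast_demand_set[OF W] measure_unif01_Icc a' b' r)
  have b_pos: "utility V p\<^sub>2 W\<^sub>2 \<theta> \<ge> 0 \<longleftrightarrow> \<theta> \<le> b" for \<theta>
    using W p2' by (auto simp: utility_def algebra_simps)
  have "utility V p\<^sub>1 W\<^sub>1 \<theta> < 0" if "\<theta> > b" for \<theta>
  proof -
    have "(b - a) * W\<^sub>1 > (b - a) * W\<^sub>2" using W ab by (intro mult_strict_left_mono) auto
    moreover have "\<theta> * W\<^sub>1 > b * W\<^sub>1" using that W by simp
    ultimately show ?thesis using p1' p2' by (simp add: utility_def algebra_simps)
  qed
  then have "{\<theta>. utility V p\<^sub>1 W\<^sub>1 \<theta> \<ge> 0 \<or> utility V p\<^sub>2 W\<^sub>2 \<theta> \<ge> 0} = {..b}"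
    using b_pos by (auto simp: not_less[symmetric])
  then show "r\<^sub>1 + r\<^sub>2 = \<Lambda> * measure unif01
      {\<theta>. utility V p\<^sub>1 W\<^sub>1 \<theta> \<ge> 0 \<or> utility V p\<^sub>2 W\<^sub>2 \<theta> \<ge> 0}"
    using ab by (simp add: measure_unif01_atMost r algebra_simps)
  show "p\<^sub>1 * r\<^sub>1 + p\<^sub>2 * r\<^sub>2
      = (r\<^sub>1 + r\<^sub>2) * V - (r\<^sub>1\<^sup>2 * W\<^sub>1 + ((r\<^sub>1 + r\<^sub>2)\<^sup>2 - r\<^sub>1\<^sup>2) * W\<^sub>2) / \<Lambda>"
    unfolding p1' p2' r using assms(1) by (simp add: field_simps power2_eq_square)
qed

text \<open>With unequal prices nobody joins the dearer service. With equal prices all three sets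
  coincide, which would give \<open>r\<^sub>1 = r\<^sub>2 = r\<^sub>1 + r\<^sub>2\<close>.\<close>

lemma no_split_of_equal_lead_times:
  assumes "r\<^sub>1 > 0" "r\<^sub>2 > 0"
    and r1: "r\<^sub>1 = \<Lambda> * measure unif01
      {\<theta>. utility V p\<^sub>1 W \<theta> \<ge> 0 \<and> utility V p\<^sub>1 W \<theta> \<ge> utility V p\<^sub>2 W \<theta>}"
    and r2: "r\<^sub>2 = \<Lambda> * measure unif01
      {\<theta>. utility V p\<^sub>2 W \<theta> \<ge> 0 \<and> utility V p\<^sub>2 W \<theta> \<ge> utility V p\<^sub>1 W \<theta>}"
    and r12: "r\<^sub>1 + r\<^sub>2 = \<Lambda> * measure unif01
      {\<theta>. utility V p\<^sub>1 W \<theta> \<ge> 0 \<or> utility V p\<^sub>2 W \<theta> \<ge> 0}"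
  shows False
proof -
  consider "p\<^sub>1 < p\<^sub>2" | "p\<^sub>2 < p\<^sub>1" | "p\<^sub>1 = p\<^sub>2" by linarith
  then show False
    using assms by cases (auto simp: utility_def)
qed

section \<open>Participation of contractors\<close>

text \<open>The hourly earnings \<open>t\<close> must cover the reservation rate
  \<open>staff_o x / K\<close> of the marginal contractor; multiplying by the number of contractors
  bounds the total wage bill from below.\<close>

lemma participation_bound:
  assumes "K > 0" "staff_o x > 0" "participation K x"
  shows "staff_o x \<le> K" "(staff_o x)\<^sup>2 / K \<le> rate_o x * wage_o x"
proof -
  define t where "t = rate_o x * wage_o x / staff_o x"
  have k: "staff_o x = K * max 0 (min 1 t)"
    using assms(3) by (simp add: participation_def t_def[symmetric] measure_unif01_atMost flip: atMost_def)
  have "t > 0" using assms(1,2) unfolding k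
    by (auto simp: zero_less_mult_iff max_def min_def split: if_splits)
  then have k': "staff_o x / K = min 1 t" using k assms by simp
  then have "staff_o x / K \<le> 1" "staff_o x / K \<le> t" by linarith+
  then show "staff_o x \<le> K" "(staff_o x)\<^sup>2 / K \<le> rate_o x * wage_o x"
    using assms unfolding t_def by (auto simp: field_simps power2_eq_square)
qed

lemma participation_attained:
  assumes "K > 0" "0 < staff_o x" "staff_o x \<le> K" "rate_o x > 0"
    and "rate_o x * wage_o x = (staff_o x)\<^sup>2 / K"
  shows "participation K x"
proof -
  have "{r. rate_o x * wage_o x / staff_o x \<ge> r} = {..staff_o x / K}"
    using assms by (auto simp: power2_eq_square)
  then show ?thesis
    unfolding participation_def using assms by (simp add: measure_unif01_atMost)
qed

section \<open>Reduced objective functions with prices, wage and number of employees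
  eliminated\<close>

locale market =
  fixes V \<Lambda> \<mu>\<^sub>s \<mu>\<^sub>o w\<^sub>s K :: real
  assumes V_pos: "V > 0" and L_pos: "\<Lambda> > 0" and mus_pos: "\<mu>\<^sub>s > 0" and muo_pos: "\<mu>\<^sub>o > 0"
    and ws_pos: "w\<^sub>s > 0" and K_pos: "K > 0"
    and V_ge: "V \<ge> w\<^sub>s / \<mu>\<^sub>s + 2 * sqrt (w\<^sub>s / (\<Lambda> * \<mu>\<^sub>s))"
begin

definition sigma :: real where
  "sigma = sqrt (w\<^sub>s / (\<Lambda> * \<mu>\<^sub>s))"

text \<open>The cost per customer, waiting included, of an optimally staffed standard service
  operating alone (\<open>net_standard\<close>). The feasible space requires it to be at most
  \<open>V\<close>.\<close>

definition unit_cost :: real where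
  "unit_cost = w\<^sub>s / \<mu>\<^sub>s + 2 * sigma"

text \<open>
  The weight \<open>q\<close> of the standard lead time in the lost revenue is \<open>l\<^sub>s\<^sup>2\<close> if the standard service
  is the slower one and \<open>(l\<^sub>s + l\<^sub>o)\<^sup>2 - l\<^sub>o\<^sup>2\<close> if it is the faster one.  Below, \<open>y = k\<^sub>s \<mu>\<^sub>s - l\<^sub>s\<close> is
  the excess capacity of the employees.
\<close>
definition gross :: "real \<Rightarrow> real \<Rightarrow> real \<Rightarrow> real \<Rightarrow> real \<Rightarrow> real" where
  "gross q y l\<^sub>s l\<^sub>o k = (l\<^sub>s + l\<^sub>o) * V - (q * (1 / y) + ((l\<^sub>s + l\<^sub>o)\<^sup>2 - q) * (1 / (k * \<mu>\<^sub>o - l\<^sub>o))) / \<Lambda>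
     - w\<^sub>s * ((l\<^sub>s + y) / \<mu>\<^sub>s) - k\<^sup>2 / K"

text \<open>For \<open>q \<ge> 0\<close>, the supremum of \<open>gross\<close> over
  \<open>y > 0\<close>; if \<open>q > 0\<close> it is attained at
  \<open>y = sqrt q / (\<Lambda> * sigma)\<close>.\<close>

definition net :: "real \<Rightarrow> real \<Rightarrow> real \<Rightarrow> real \<Rightarrow> real" where
  "net q l\<^sub>s l\<^sub>o k = (l\<^sub>s + l\<^sub>o) * V - w\<^sub>s * l\<^sub>s / \<mu>\<^sub>s - 2 * sigma * sqrt q
     - ((l\<^sub>s + l\<^sub>o)\<^sup>2 - q) / (\<Lambda> * (k * \<mu>\<^sub>o - l\<^sub>o)) - k\<^sup>2 / K"

text \<open>The two weights belong to the two orders of the lead times, but no order is imposed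
  here. It is thus first an upper bound; that plans attain it is shown separately.\<close>

definition best :: "real \<Rightarrow> real \<Rightarrow> real \<Rightarrow> real" where
  "best l\<^sub>s l\<^sub>o k = max (net (l\<^sub>s\<^sup>2) l\<^sub>s l\<^sub>o k) (net ((l\<^sub>s + l\<^sub>o)\<^sup>2 - l\<^sub>o\<^sup>2) l\<^sub>s l\<^sub>o k)"

text \<open>The boundary \<open>l\<^sub>s = 0\<close> is included so that on-demand plans are
  covered as well.\<close>

definition admissible :: "real \<Rightarrow> real \<Rightarrow> real \<Rightarrow> bool" where
  "admissible l\<^sub>s l\<^sub>o k \<longleftrightarrow> 0 \<le> l\<^sub>s \<and> 0 < l\<^sub>o \<and> l\<^sub>s + l\<^sub>o \<le> \<Lambda> \<and> k \<le> K \<and> l\<^sub>o < k * \<mu>\<^sub>o"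

lemma sigma_pos: "sigma > 0"
  unfolding sigma_def using ws_pos L_pos mus_pos by simp

lemma sigma_sq: "\<Lambda> * sigma\<^sup>2 = w\<^sub>s / \<mu>\<^sub>s"
  unfolding sigma_def using ws_pos L_pos mus_pos by simp

lemma unit_cost_le: "unit_cost \<le> V"
  using V_ge by (simp add: unit_cost_def sigma_def)

lemma admissible_staff_pos: "admissible l\<^sub>s l\<^sub>o k \<Longrightarrow> k > 0"
  unfolding admissible_def using muo_pos by (smt (verit) mult_nonpos_nonneg)

text \<open>The terms in \<open>y\<close> are
  \<open>q / (\<Lambda> * y) + w\<^sub>s * y / \<mu>\<^sub>s\<close>; since
  \<open>w\<^sub>s / \<mu>\<^sub>s = \<Lambda> * sigma\<^sup>2\<close>, they equal
  \<open>2 * sigma * sqrt q\<close> plus a square over \<open>\<Lambda> * y\<close>.\<close>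

lemma gross_eq_net:
  assumes "y > 0" "q \<ge> 0"
  shows "gross q y l\<^sub>s l\<^sub>o k = net q l\<^sub>s l\<^sub>o k - (sqrt q - \<Lambda> * sigma * y)\<^sup>2 / (\<Lambda> * y)"
proof -
  have "(sqrt q - \<Lambda> * sigma * y)\<^sup>2 = q - 2 * sqrt q * (\<Lambda> * sigma * y) + \<Lambda> * y\<^sup>2 * (\<Lambda> * sigma\<^sup>2)"
    using assms by (simp add: power2_diff power_mult_distrib power2_eq_square algebra_simps)
  then have "(sqrt q - \<Lambda> * sigma * y)\<^sup>2 / (\<Lambda> * y) = q / (\<Lambda> * y) - 2 * sigma * sqrt q + w\<^sub>s * y / \<mu>\<^sub>s"
    unfolding sigma_sq using assms L_pos mus_pos by (simp add: field_simps power2_eq_square)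
  then show ?thesis
    unfolding gross_def net_def using assms L_pos mus_pos
    by (simp add: add_divide_distrib distrib_left distrib_right mult.commute)
qed

lemma gross_le_net:
  assumes "y > 0" "q \<ge> 0"
  shows "gross q y l\<^sub>s l\<^sub>o k \<le> net q l\<^sub>s l\<^sub>o k"
  using gross_eq_net[OF assms] assms L_pos by simp

lemma net_standard: "l \<ge> 0 \<Longrightarrow> net (l\<^sup>2) l 0 k = l * (V - unit_cost) - k\<^sup>2 / K"
  by (simp add: net_def unit_cost_def algebra_simps)

text \<open>Since \<open>sqrt q \<ge> l\<^sub>s\<close>, the standard customers contribute at most
  \<open>l\<^sub>s * (V - unit_cost)\<close>. Any gain over the standard service alone is thus
  controlled by \<open>l\<^sub>o\<close> and the spare capacity of the contractors, which later
  yields compactness.\<close>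

lemma net_le:
  assumes "admissible l\<^sub>s l\<^sub>o k" "l\<^sub>s\<^sup>2 \<le> q" "q \<le> (l\<^sub>s + l\<^sub>o)\<^sup>2 - l\<^sub>o\<^sup>2"
  shows "net q l\<^sub>s l\<^sub>o k \<le> \<Lambda> * (V - unit_cost) + l\<^sub>o * V - l\<^sub>o\<^sup>2 / (\<Lambda> * (k * \<mu>\<^sub>o - l\<^sub>o))"
proof -
  have a: "0 \<le> l\<^sub>s" "0 < l\<^sub>o" "l\<^sub>s + l\<^sub>o \<le> \<Lambda>" "l\<^sub>o < k * \<mu>\<^sub>o" using assms by (auto simp: admissible_def)
  have "l\<^sub>s \<le> sqrt q" using assms(2) by (rule real_le_rsqrt)
  then have "2 * sigma * l\<^sub>s \<le> 2 * sigma * sqrt q" using sigma_pos by simp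
  moreover have "l\<^sub>o\<^sup>2 / (\<Lambda> * (k * \<mu>\<^sub>o - l\<^sub>o)) \<le> ((l\<^sub>s + l\<^sub>o)\<^sup>2 - q) / (\<Lambda> * (k * \<mu>\<^sub>o - l\<^sub>o))"
    using assms a L_pos by (intro divide_right_mono) auto
  moreover have "l\<^sub>s * (V - unit_cost) \<le> \<Lambda> * (V - unit_cost)"
    using a unit_cost_le by (intro mult_right_mono) auto
  moreover have "k\<^sup>2 / K \<ge> 0" using K_pos by simp
  ultimately show ?thesis unfolding net_def unit_cost_def by (simp add: algebra_simps)
qed

lemma best_le:
  assumes "admissible l\<^sub>s l\<^sub>o k"
  shows "best l\<^sub>s l\<^sub>o k \<le> \<Lambda> * (V - unit_cost) + l\<^sub>o * V - l\<^sub>o\<^sup>2 / (\<Lambda> * (k * \<mu>\<^sub>o - l\<^sub>o))"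
proof -
  have "l\<^sub>s\<^sup>2 \<le> (l\<^sub>s + l\<^sub>o)\<^sup>2 - l\<^sub>o\<^sup>2"
    using assms by (simp add: admissible_def power2_sum)
  then show ?thesis unfolding best_def using net_le[OF assms] by (auto simp: max_def)
qed

section \<open>The standard service alone\<close>

lemma profit_standard_le:
  assumes "feasible V \<Lambda> \<mu>\<^sub>s \<mu>\<^sub>o K Standard_Only x"
  shows "profit w\<^sub>s x \<le> \<Lambda> * (V - unit_cost)"
proof -
  define y where "y = staff_s x * \<mu>\<^sub>s - rate_s x"
  from assms have f: "rate_s x > 0" "rate_o x = 0" "rate_s x < staff_s x * \<mu>\<^sub>s" "lead_s x = 1 / y"
    "rate_s x = \<Lambda> * measure unif01 {\<theta>. utility V (price_s x) (lead_s x) \<theta> \<ge> 0}"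
    unfolding feasible.simps lead_time_def y_def by blast+
  have y: "y > 0" using f(3) by (simp add: y_def)
  then have W: "lead_s x > 0" using f(4) by simp
  note b = single_demand_bound[OF L_pos W f(1) f(5)]
  have k: "staff_s x = (rate_s x + y) / \<mu>\<^sub>s" using mus_pos by (simp add: y_def)
  \<comment> \<open>With \<open>l\<^sub>o = 0\<close> and \<open>q = l\<^sub>s\<^sup>2\<close> the
    on-demand lead time has weight 0, so its value \<open>1 / 0\<close> is harmless.\<close>
  have "profit w\<^sub>s x \<le> gross ((rate_s x)\<^sup>2) y (rate_s x) 0 0"
    unfolding profit_def gross_def f(2) k using b(2) f(4) by simp
  also have "\<dots> \<le> net ((rate_s x)\<^sup>2) (rate_s x) 0 0" using y by (intro gross_le_net) auto
  also have "\<dots> = rate_s x * (V - unit_cost)" using f(1) by (subst net_standard) auto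
  also have "\<dots> \<le> \<Lambda> * (V - unit_cost)" using b(1) unit_cost_le by (intro mult_right_mono) auto
  finally show ?thesis .
qed

lemma profit_standard_attained:
  "\<exists>x. feasible V \<Lambda> \<mu>\<^sub>s \<mu>\<^sub>o K Standard_Only x \<and> profit w\<^sub>s x = \<Lambda> * (V - unit_cost)"
proof -
  \<comment> \<open>The zero of the square in \<open>gross_eq_net\<close> for
    \<open>q = \<Lambda>\<^sup>2\<close>.\<close>
  define y where "y = 1 / sigma"
  have y: "y > 0" using sigma_pos by (simp add: y_def)
  define W where "W = 1 / y"
  have W: "W > 0" using y by (simp add: W_def)
  define x where "x = \<lparr>price_s = V - \<Lambda> / \<Lambda> * W, price_o = 0, staff_s = (\<Lambda> + y) / \<mu>\<^sub>s, wage_o = 0,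
    rate_s = \<Lambda>, rate_o = 0, lead_s = W, lead_o = 0, staff_o = 0\<rparr>"
  note d = single_demand_attained[OF L_pos W L_pos order_refl refl, of V]
  have "feasible V \<Lambda> \<mu>\<^sub>s \<mu>\<^sub>o K Standard_Only x"
    using d(1) L_pos mus_pos y by (simp add: x_def lead_time_def W_def)
  moreover have "profit w\<^sub>s x = gross (\<Lambda>\<^sup>2) y \<Lambda> 0 0"
    unfolding profit_def gross_def using d(2) by (simp add: x_def W_def)
  then have "profit w\<^sub>s x = \<Lambda> * (V - unit_cost)"
    using gross_eq_net[of y "\<Lambda>\<^sup>2" \<Lambda> 0 0] y L_pos sigma_pos net_standard[of \<Lambda> 0] by (simp add: y_def)
  ultimately show ?thesis by blast
qed

section \<open>The on-demand service alone\<close>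

text \<open>For \<open>l\<^sub>s = 0\<close> both weights vanish and the two expressions
  coincide.\<close>

lemma best_on_demand:
  "best 0 l k = l * V - l\<^sup>2 * (1 / (k * \<mu>\<^sub>o - l)) / \<Lambda> - k\<^sup>2 / K"
  by (simp add: best_def net_def mult.commute)

lemma profit_on_demand_le:
  assumes "feasible V \<Lambda> \<mu>\<^sub>s \<mu>\<^sub>o K On_Demand_Only x"
  shows "admissible 0 (rate_o x) (staff_o x) \<and> profit w\<^sub>s x \<le> best 0 (rate_o x) (staff_o x)"
proof -
  from assms have f: "rate_o x > 0" "rate_s x = 0" "staff_s x = 0" "rate_o x < staff_o x * \<mu>\<^sub>o"
    "lead_o x = 1 / (staff_o x * \<mu>\<^sub>o - rate_o x)" "participation K x"
    "rate_o x = \<Lambda> * measure unif01 {\<theta>. utility V (price_o x) (lead_o x) \<theta> \<ge> 0}"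
    unfolding feasible.simps lead_time_def by blast+
  have W: "lead_o x > 0" using f(4) unfolding f(5) by simp
  have k: "staff_o x > 0" using f(1,4) muo_pos by (smt (verit) mult_nonpos_nonneg)
  note b = single_demand_bound[OF L_pos W f(1) f(7)]
  note c = participation_bound[OF K_pos k f(6)]
  show ?thesis
    unfolding admissible_def best_on_demand profit_def
    using b(1) b(2)[unfolded f(5)] c f(1-4) by simp
qed

lemma best_attained_on_demand:
  assumes "admissible 0 l k"
  shows "\<exists>x. feasible V \<Lambda> \<mu>\<^sub>s \<mu>\<^sub>o K On_Demand_Only x \<and> profit w\<^sub>s x = best 0 l k"
proof -
  have a: "0 < l" "l \<le> \<Lambda>" "k \<le> K" "l < k * \<mu>\<^sub>o" using assms by (auto simp: admissible_def)
  have k: "k > 0" using assms by (rule admissible_staff_pos)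
  define W where "W = 1 / (k * \<mu>\<^sub>o - l)"
  have W: "W > 0" using a by (simp add: W_def)
  \<comment> \<open>The wage makes the total wage bill exactly \<open>k\<^sup>2 / K\<close>, the
    least that attracts \<open>k\<close> contractors.\<close>
  define x where "x = \<lparr>price_s = 0, price_o = V - l / \<Lambda> * W, staff_s = 0, wage_o = k\<^sup>2 / K / l,
    rate_s = 0, rate_o = l, lead_s = 0, lead_o = W, staff_o = k\<rparr>"
  note d = single_demand_attained[OF L_pos W a(1,2) refl, of V]
  have "participation K x"
    using K_pos k a by (intro participation_attained) (simp_all add: x_def)
  then have "feasible V \<Lambda> \<mu>\<^sub>s \<mu>\<^sub>o K On_Demand_Only x"
    using d(1) a by (simp add: x_def lead_time_def W_def)
  moreover have "profit w\<^sub>s x = best 0 l k"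
    unfolding best_on_demand profit_def using d(2) a by (simp add: x_def W_def)
  ultimately show ?thesis by blast
qed

section \<open>Two services\<close>

text \<open>The order of the lead times selects the weight: the revenue bound for that order and the
  wage bound lead to \<open>gross\<close>, and optimal staffing leads to \<open>net\<close>.\<close>

lemma profit_two_le:
  assumes "feasible V \<Lambda> \<mu>\<^sub>s \<mu>\<^sub>o K Two_Services x"
  shows "admissible (rate_s x) (rate_o x) (staff_o x) \<and>
    profit w\<^sub>s x \<le> best (rate_s x) (rate_o x) (staff_o x)"
proof -
  let ?Us = "utility V (price_s x) (lead_s x)" and ?Uo = "utility V (price_o x) (lead_o x)"
  let ?ls = "rate_s x" and ?lo = "rate_o x"
  define y where "y = staff_s x * \<mu>\<^sub>s - ?ls"
  from assms have f: "?ls > 0" "?lo > 0" "?lo < staff_o x * \<mu>\<^sub>o" "?ls < staff_s x * \<mu>\<^sub>s" "lead_s x = 1 / y"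
    "lead_o x = 1 / (staff_o x * \<mu>\<^sub>o - ?lo)" "participation K x"
    and rs: "?ls = \<Lambda> * measure unif01 {\<theta>. ?Us \<theta> \<ge> 0 \<and> ?Us \<theta> \<ge> ?Uo \<theta>}"
    and ro: "?lo = \<Lambda> * measure unif01 {\<theta>. ?Uo \<theta> \<ge> 0 \<and> ?Uo \<theta> \<ge> ?Us \<theta>}"
    and rso: "?ls + ?lo = \<Lambda> * measure unif01 {\<theta>. ?Us \<theta> \<ge> 0 \<or> ?Uo \<theta> \<ge> 0}"
    unfolding feasible.simps lead_time_def y_def Let_def by blast+
  have y: "y > 0" using f(4) by (simp add: y_def)
  have W: "lead_s x > 0" "lead_o x > 0" using y f(3) unfolding f(5,6) by simp_all
  have k: "staff_o x > 0" using f(2,3) muo_pos by (smt (verit) mult_nonpos_nonneg)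
  note c = participation_bound[OF K_pos k f(7)]
  have ks: "staff_s x = (?ls + y) / \<mu>\<^sub>s" using mus_pos by (simp add: y_def)
  consider "lead_o x < lead_s x" | "lead_s x < lead_o x" | "lead_s x = lead_o x" by linarith
  then show ?thesis
  proof cases
    case 1
    note b = split_demand_bound[OF L_pos W(2) 1 f(1,2) rs ro]
    have "profit w\<^sub>s x \<le> gross (?ls\<^sup>2) y ?ls ?lo (staff_o x)"
      unfolding profit_def gross_def ks using b(2) c(2) unfolding f(5,6) by linarith
    also have "\<dots> \<le> net (?ls\<^sup>2) ?ls ?lo (staff_o x)" using y by (intro gross_le_net) auto
    finally show ?thesis using b(1) c(1) f(1-3) by (auto simp: admissible_def best_def)
  next
    case 2
    note b = split_demand_bound[OF L_pos W(1) 2 f(2,1) ro rs]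
    \<comment> \<open>With the standard service in the fast role, the lost revenue is regrouped by
      lead times into the shape used in \<open>gross\<close>.\<close>
    have q: "?lo\<^sup>2 * W\<^sub>o + ((?lo + ?ls)\<^sup>2 - ?lo\<^sup>2) * W\<^sub>s
      = ((?ls + ?lo)\<^sup>2 - ?lo\<^sup>2) * W\<^sub>s + ((?ls + ?lo)\<^sup>2 - ((?ls + ?lo)\<^sup>2 - ?lo\<^sup>2)) * W\<^sub>o" for W\<^sub>s W\<^sub>o
      by (simp add: algebra_simps)
    have "profit w\<^sub>s x \<le> gross ((?ls + ?lo)\<^sup>2 - ?lo\<^sup>2) y ?ls ?lo (staff_o x)"
      unfolding profit_def gross_def ks using b(2)[unfolded q] c(2) unfolding f(5,6) add.commute[of ?lo ?ls]
      by linarith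
    also have "\<dots> \<le> net ((?ls + ?lo)\<^sup>2 - ?lo\<^sup>2) ?ls ?lo (staff_o x)"
      using y f(1,2) by (intro gross_le_net) (auto simp: power2_sum)
    finally show ?thesis using b(1) c(1) f(1-3) by (auto simp: admissible_def best_def)
  next
    case 3
    show ?thesis
      using no_split_of_equal_lead_times[OF f(1,2), of \<Lambda> V "price_s x" "lead_s x" "price_o x"] rs ro rso
      unfolding 3 by blast
  qed
qed

lemma two_services_slow_standard:
  assumes "admissible l\<^sub>s l\<^sub>o k" "l\<^sub>s > 0" "y > 0" "1 / (k * \<mu>\<^sub>o - l\<^sub>o) < 1 / y"
  shows "\<exists>x. feasible V \<Lambda> \<mu>\<^sub>s \<mu>\<^sub>o K Two_Services x \<and> profit w\<^sub>s x = gross (l\<^sub>s\<^sup>2) y l\<^sub>s l\<^sub>o k"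
proof -
  have a: "0 < l\<^sub>o" "l\<^sub>s + l\<^sub>o \<le> \<Lambda>" "k \<le> K" "l\<^sub>o < k * \<mu>\<^sub>o" using assms by (auto simp: admissible_def)
  have k: "k > 0" using assms(1) by (rule admissible_staff_pos)
  define W\<^sub>s where "W\<^sub>s = 1 / y"
  define W\<^sub>o where "W\<^sub>o = 1 / (k * \<mu>\<^sub>o - l\<^sub>o)"
  have W: "0 < W\<^sub>o" "W\<^sub>o < W\<^sub>s" using a assms by (auto simp: W\<^sub>s_def W\<^sub>o_def)
  define p\<^sub>o where "p\<^sub>o = V - (l\<^sub>s + l\<^sub>o) / \<Lambda> * W\<^sub>o"
  define p\<^sub>s where "p\<^sub>s = p\<^sub>o - l\<^sub>s / \<Lambda> * (W\<^sub>s - W\<^sub>o)"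
  note d = split_demand_attained[OF L_pos W assms(2) a(1,2) p\<^sub>o_def p\<^sub>s_def]
  define x where "x = \<lparr>price_s = p\<^sub>s, price_o = p\<^sub>o, staff_s = (l\<^sub>s + y) / \<mu>\<^sub>s, wage_o = k\<^sup>2 / K / l\<^sub>o,
    rate_s = l\<^sub>s, rate_o = l\<^sub>o, lead_s = W\<^sub>s, lead_o = W\<^sub>o, staff_o = k\<rparr>"
  have sel: "price_s x = p\<^sub>s" "price_o x = p\<^sub>o" "staff_s x = (l\<^sub>s + y) / \<mu>\<^sub>s" "rate_s x = l\<^sub>s"
    "rate_o x = l\<^sub>o" "lead_s x = W\<^sub>s" "lead_o x = W\<^sub>o" "staff_o x = k"
    by (simp_all add: x_def)
  have lead: "l\<^sub>s < (l\<^sub>s + y) / \<mu>\<^sub>s * \<mu>\<^sub>s" "W\<^sub>s = 1 / ((l\<^sub>s + y) / \<mu>\<^sub>s * \<mu>\<^sub>s - l\<^sub>s)"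
    using mus_pos assms(3) by (simp_all add: W\<^sub>s_def)
  have "participation K x"
    using K_pos k a by (intro participation_attained) (simp_all add: x_def)
  then have "feasible V \<Lambda> \<mu>\<^sub>s \<mu>\<^sub>o K Two_Services x"
    unfolding feasible.simps lead_time_def Let_def sel
    using d(1-3) a(1,4) assms(2) lead W\<^sub>o_def by blast
  moreover have "profit w\<^sub>s x = gross (l\<^sub>s\<^sup>2) y l\<^sub>s l\<^sub>o k"
    unfolding profit_def gross_def using d(4) a by (simp add: x_def W\<^sub>s_def W\<^sub>o_def)
  ultimately show ?thesis by blast
qed

text \<open>The counterpart of \<open>two_services_slow_standard\<close> with the roles in
  \<open>split_demand_attained\<close> exchanged.\<close>

lemma two_services_fast_standard:
  assumes "admissible l\<^sub>s l\<^sub>o k" "l\<^sub>s > 0" "y > 0" "1 / y < 1 / (k * \<mu>\<^sub>o - l\<^sub>o)"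
  shows "\<exists>x. feasible V \<Lambda> \<mu>\<^sub>s \<mu>\<^sub>o K Two_Services x \<and>
    profit w\<^sub>s x = gross ((l\<^sub>s + l\<^sub>o)\<^sup>2 - l\<^sub>o\<^sup>2) y l\<^sub>s l\<^sub>o k"
proof -
  have a: "0 < l\<^sub>o" "l\<^sub>o + l\<^sub>s \<le> \<Lambda>" "k \<le> K" "l\<^sub>o < k * \<mu>\<^sub>o" using assms by (auto simp: admissible_def)
  have k: "k > 0" using assms(1) by (rule admissible_staff_pos)
  define W\<^sub>s where "W\<^sub>s = 1 / y"
  define W\<^sub>o where "W\<^sub>o = 1 / (k * \<mu>\<^sub>o - l\<^sub>o)"
  have W: "0 < W\<^sub>s" "W\<^sub>s < W\<^sub>o" using a assms by (auto simp: W\<^sub>s_def W\<^sub>o_def)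
  define p\<^sub>s where "p\<^sub>s = V - (l\<^sub>o + l\<^sub>s) / \<Lambda> * W\<^sub>s"
  define p\<^sub>o where "p\<^sub>o = p\<^sub>s - l\<^sub>o / \<Lambda> * (W\<^sub>o - W\<^sub>s)"
  note d = split_demand_attained[OF L_pos W a(1) assms(2) a(2) p\<^sub>s_def p\<^sub>o_def]
  define x where "x = \<lparr>price_s = p\<^sub>s, price_o = p\<^sub>o, staff_s = (l\<^sub>s + y) / \<mu>\<^sub>s, wage_o = k\<^sup>2 / K / l\<^sub>o,
    rate_s = l\<^sub>s, rate_o = l\<^sub>o, lead_s = W\<^sub>s, lead_o = W\<^sub>o, staff_o = k\<rparr>"
  have sel: "price_s x = p\<^sub>s" "price_o x = p\<^sub>o" "staff_s x = (l\<^sub>s + y) / \<mu>\<^sub>s" "rate_s x = l\<^sub>s"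
    "rate_o x = l\<^sub>o" "lead_s x = W\<^sub>s" "lead_o x = W\<^sub>o" "staff_o x = k"
    by (simp_all add: x_def)
  have lead: "l\<^sub>s < (l\<^sub>s + y) / \<mu>\<^sub>s * \<mu>\<^sub>s" "W\<^sub>s = 1 / ((l\<^sub>s + y) / \<mu>\<^sub>s * \<mu>\<^sub>s - l\<^sub>s)"
    using mus_pos assms(3) by (simp_all add: W\<^sub>s_def)
  have "participation K x"
    using K_pos k a by (intro participation_attained) (simp_all add: x_def)
  moreover have "l\<^sub>s + l\<^sub>o = \<Lambda> * measure unif01
      {\<theta>. utility V p\<^sub>s W\<^sub>s \<theta> \<ge> 0 \<or> utility V p\<^sub>o W\<^sub>o \<theta> \<ge> 0}"
    using d(3) by (simp add: disj_commute add.commute)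
  ultimately have "feasible V \<Lambda> \<mu>\<^sub>s \<mu>\<^sub>o K Two_Services x"
    unfolding feasible.simps lead_time_def Let_def sel
    using d(1,2) a(1,4) assms(2) lead W\<^sub>o_def by blast
  moreover have "profit w\<^sub>s x = gross ((l\<^sub>s + l\<^sub>o)\<^sup>2 - l\<^sub>o\<^sup>2) y l\<^sub>s l\<^sub>o k"
    unfolding profit_def gross_def using d(4) a
    by (simp add: x_def W\<^sub>s_def W\<^sub>o_def add.commute)
  ultimately show ?thesis by blast
qed

text \<open>
  At the staffing level that is optimal for one ordering \<open>q\<close> of the lead times, the other ordering
  \<open>q'\<close> has a suboptimal staffing level.
\<close>
lemma gross_optimal_staffing:
  assumes "0 < q" "0 \<le> q'" "q \<noteq> q'" "net q' l\<^sub>s l\<^sub>o k \<le> net q l\<^sub>s l\<^sub>o k"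
  obtains y where "y > 0" "gross q y l\<^sub>s l\<^sub>o k = net q l\<^sub>s l\<^sub>o k"
    "0 < (q - q') * (1 / (k * \<mu>\<^sub>o - l\<^sub>o) - 1 / y)"
proof
  let ?y = "sqrt q / (\<Lambda> * sigma)"
  show y: "?y > 0" using assms sigma_pos L_pos by simp
  have e: "\<Lambda> * sigma * ?y = sqrt q" using sigma_pos L_pos by simp
  show opt: "gross q ?y l\<^sub>s l\<^sub>o k = net q l\<^sub>s l\<^sub>o k"
    using gross_eq_net[OF y, of q] assms unfolding e by simp
  have "(sqrt q' - sqrt q)\<^sup>2 / (\<Lambda> * ?y) > 0"
    using assms(3) by (intro divide_pos_pos mult_pos_pos y L_pos) simp
  then have "gross q' ?y l\<^sub>s l\<^sub>o k < gross q ?y l\<^sub>s l\<^sub>o k"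
    using gross_eq_net[OF y, of q' l\<^sub>s l\<^sub>o k] assms opt unfolding e by linarith
  \<comment> \<open>For fixed staffing, changing the weight matters only through the difference of
    the lead times, so the strict gain determines their order.\<close>
  moreover have "gross q ?y l\<^sub>s l\<^sub>o k - gross q' ?y l\<^sub>s l\<^sub>o k
      = (q - q') * (1 / (k * \<mu>\<^sub>o - l\<^sub>o) - 1 / ?y) / \<Lambda>"
    unfolding gross_def using L_pos by (simp add: diff_divide_distrib add_divide_distrib algebra_simps)
  ultimately have "0 < (q - q') * (1 / (k * \<mu>\<^sub>o - l\<^sub>o) - 1 / ?y) / \<Lambda>" by linarith
  then show "0 < (q - q') * (1 / (k * \<mu>\<^sub>o - l\<^sub>o) - 1 / ?y)"
    using L_pos by (simp only: zero_less_divide_iff) linarith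
qed

text \<open>This works at every such admissible point, maximal or not: optimal staffing for the
  larger expression forces exactly the order of lead times that this expression presupposes, so its
  plan is feasible.\<close>

lemma best_attained_two:
  assumes "admissible l\<^sub>s l\<^sub>o k" "l\<^sub>s > 0"
  shows "\<exists>x. feasible V \<Lambda> \<mu>\<^sub>s \<mu>\<^sub>o K Two_Services x \<and> profit w\<^sub>s x = best l\<^sub>s l\<^sub>o k"
proof -
  let ?q = "l\<^sub>s\<^sup>2" and ?r = "(l\<^sub>s + l\<^sub>o)\<^sup>2 - l\<^sub>o\<^sup>2"
  have "l\<^sub>o > 0" using assms by (simp add: admissible_def)
  then have qr: "0 < ?q" "?q < ?r" using assms by (auto simp: power2_sum)
  then have qr': "0 \<le> ?q" "0 < ?r" "0 \<le> ?r" "?q \<noteq> ?r" by linarith+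
  consider (slow) "net ?r l\<^sub>s l\<^sub>o k \<le> net ?q l\<^sub>s l\<^sub>o k" | (fast) "net ?q l\<^sub>s l\<^sub>o k \<le> net ?r l\<^sub>s l\<^sub>o k"
    by linarith
  then show ?thesis
  proof cases
    case slow
    obtain y where y: "y > 0" "gross ?q y l\<^sub>s l\<^sub>o k = net ?q l\<^sub>s l\<^sub>o k"
      "0 < (?q - ?r) * (1 / (k * \<mu>\<^sub>o - l\<^sub>o) - 1 / y)"
      using gross_optimal_staffing[OF qr(1) qr'(3,4) slow] by blast
    have "1 / (k * \<mu>\<^sub>o - l\<^sub>o) < 1 / y" using y(3) qr by (simp only: zero_less_mult_iff) linarith
    from two_services_slow_standard[OF assms y(1) this] show ?thesis
      using slow y(2) by (simp add: best_def max_def)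
  next
    case fast
    obtain y where y: "y > 0" "gross ?r y l\<^sub>s l\<^sub>o k = net ?r l\<^sub>s l\<^sub>o k"
      "0 < (?r - ?q) * (1 / (k * \<mu>\<^sub>o - l\<^sub>o) - 1 / y)"
      using gross_optimal_staffing[OF qr'(2,1) qr'(4)[symmetric] fast] by blast
    have "1 / y < 1 / (k * \<mu>\<^sub>o - l\<^sub>o)" using y(3) qr by (simp only: zero_less_mult_iff) linarith
    from two_services_fast_standard[OF assms y(1) this] show ?thesis
      using fast y(2) by (simp add: best_def max_def)
  qed
qed

section \<open>Existence of an optimum\<close>

text \<open>
  The superlevel sets of \<open>best\<close> above the profit of the standard service are compact, because there
  \<open>l\<^sub>o\<close> and \<open>k \<mu>\<^sub>o - l\<^sub>o\<close> are bounded away from 0.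
\<close>
lemma best_has_maximum:
  assumes adm0: "admissible l0 m0 k0" and gt: "\<Lambda> * (V - unit_cost) < best l0 m0 k0"
  shows "\<exists>l\<^sub>s l\<^sub>o k. admissible l\<^sub>s l\<^sub>o k \<and>
    (\<forall>l' m' k'. admissible l' m' k' \<longrightarrow> best l' m' k' \<le> best l\<^sub>s l\<^sub>o k)"
proof -
  let ?P = "\<Lambda> * (V - unit_cost)"
  \<comment> \<open>By \<open>best_le\<close>, the gain over \<open>?P\<close> is at most
    \<open>m * V\<close>, so a point at least as good as \<open>(l0, m0, k0)\<close> has
    \<open>m \<ge> \<epsilon>\<close>.\<close>
  define \<epsilon> where "\<epsilon> = (best l0 m0 k0 - ?P) / V"
  have eps: "\<epsilon> > 0" using gt V_pos by (simp add: \<epsilon>_def)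
  \<comment> \<open>From \<open>m\<^sup>2 / (\<Lambda> * (k * \<mu>\<^sub>o - m)) \<le> m * V \<le>
    \<Lambda> * V\<close> the spare capacity is at least \<open>m\<^sup>2 / B\<close>.\<close>
  define B where "B = \<Lambda> * V * \<Lambda>"
  have B: "B > 0" using V_pos L_pos by (simp add: B_def)
  define f where "f = (\<lambda>z :: real \<times> real \<times> real. best (fst z) (fst (snd z)) (snd (snd z)))"
  \<comment> \<open>A compact set of admissible points that contains the superlevel set at
    \<open>(l0, m0, k0)\<close>; it may be larger.\<close>
  define C where "C = {z :: real \<times> real \<times> real. 0 \<le> fst z \<and> \<epsilon> \<le> fst (snd z) \<and>
    fst z + fst (snd z) \<le> \<Lambda> \<and> snd (snd z) \<le> K \<and>
    \<epsilon>\<^sup>2 / B \<le> snd (snd z) * \<mu>\<^sub>o - fst (snd z)}"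
  have in_C: "(l, m, k) \<in> C" if adm: "admissible l m k" and ge: "best l0 m0 k0 \<le> best l m k" for l m k
  proof -
    have a: "0 \<le> l" "0 < m" "l + m \<le> \<Lambda>" "k \<le> K" "k * \<mu>\<^sub>o - m > 0"
      using adm by (auto simp: admissible_def)
    have bl: "best l0 m0 k0 \<le> ?P + m * V - m\<^sup>2 / (\<Lambda> * (k * \<mu>\<^sub>o - m))"
      using best_le[OF adm] ge by linarith
    have nn: "m\<^sup>2 / (\<Lambda> * (k * \<mu>\<^sub>o - m)) \<ge> 0" using a L_pos by simp
    have em: "\<epsilon> \<le> m" unfolding \<epsilon>_def using bl nn V_pos by (simp add: pos_divide_le_eq)
    have "m\<^sup>2 / (\<Lambda> * (k * \<mu>\<^sub>o - m)) \<le> m * V" using bl gt by linarith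
    also have "\<dots> \<le> \<Lambda> * V" using a V_pos by (intro mult_right_mono) auto
    finally have "m\<^sup>2 \<le> (k * \<mu>\<^sub>o - m) * B"
      using a L_pos by (simp add: pos_divide_le_eq B_def algebra_simps)
    moreover have "\<epsilon>\<^sup>2 \<le> m\<^sup>2" using em eps by (intro power_mono) auto
    ultimately have "\<epsilon>\<^sup>2 / B \<le> k * \<mu>\<^sub>o - m" using B
      by (subst pos_divide_le_eq) linarith+
    then show ?thesis using a em by (simp add: C_def)
  qed
  have C_adm: "admissible l m k" if "(l, m, k) \<in> C" for l m k
  proof -
    have "\<epsilon>\<^sup>2 / B > 0" using eps B by simp
    then show ?thesis using that eps by (auto simp: C_def admissible_def)
  qed
  have "closed C"
    unfolding C_def by (intro closed_Collect_conj closed_Collect_le continuous_intros)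
  moreover have "C \<subseteq> {0..\<Lambda>} \<times> {0..\<Lambda>} \<times> {0..K}"
  proof
    fix z assume "z \<in> C"
    moreover obtain l m k where z: "z = (l, m, k)" by (cases z)
    ultimately have "admissible l m k" using C_adm by simp
    then show "z \<in> {0..\<Lambda>} \<times> {0..\<Lambda>} \<times> {0..K}"
      using admissible_staff_pos[of l m k] z by (simp add: admissible_def)
  qed
  moreover have "compact ({0..\<Lambda>} \<times> {0..\<Lambda>} \<times> {0..K})" by (intro compact_Times compact_Icc)
  ultimately have "compact C"
    by (metis compact_Int_closed Int_absorb1)
  moreover have "C \<noteq> {}" using in_C[OF adm0] by auto
  moreover have "continuous_on C f"
  proof -
    have "\<Lambda> * (snd (snd z) * \<mu>\<^sub>o - fst (snd z)) \<noteq> 0" if "z \<in> C" for z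
      using that C_adm[of "fst z" "fst (snd z)" "snd (snd z)"] L_pos by (simp add: admissible_def)
    moreover have "K \<noteq> 0" "\<mu>\<^sub>s \<noteq> 0" using K_pos mus_pos by simp_all
    ultimately show ?thesis unfolding f_def best_def net_def
      by (intro continuous_on_max continuous_on_diff continuous_on_divide continuous_on_add
          continuous_on_mult continuous_on_power continuous_on_const continuous_on_real_sqrt
          continuous_on_fst continuous_on_snd continuous_on_id) simp_all
  qed
  ultimately obtain z where z: "z \<in> C" "\<forall>z'\<in>C. f z' \<le> f z"
    using continuous_attains_sup by blast
  obtain l m k where lmk: "z = (l, m, k)" by (cases z)
  have mx: "best l' m' k' \<le> best l m k" if "(l', m', k') \<in> C" for l' m' k'
    using bspec[OF z(2) that] by (simp add: f_def lmk)
  \<comment> \<open>An admissible point outside \<open>C\<close> has a smaller value than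
    \<open>(l0, m0, k0)\<close>, which lies in \<open>C\<close>.\<close>
  have "best l' m' k' \<le> best l m k" if "admissible l' m' k'" for l' m' k'
    using mx[OF in_C[OF that]] mx[OF in_C[OF adm0]] by linarith
  moreover have "admissible l m k" using z(1) lmk C_adm by simp
  ultimately show ?thesis by blast
qed

lemma optimal_deployment_exists: "\<exists>d. optimal_deployment V \<Lambda> \<mu>\<^sub>s \<mu>\<^sub>o w\<^sub>s K d"
proof -
  let ?P = "\<Lambda> * (V - unit_cost)"
  have bound: "profit w\<^sub>s y \<le> M"
    if "feasible V \<Lambda> \<mu>\<^sub>s \<mu>\<^sub>o K d y" and P: "?P \<le> M"
      and adm: "\<And>l m k. admissible l m k \<Longrightarrow> best l m k \<le> M" for d y M
  proof (cases d)
    case Standard_Only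
    with that(1) have "feasible V \<Lambda> \<mu>\<^sub>s \<mu>\<^sub>o K Standard_Only y" by (simp only:)
    from profit_standard_le[OF this] P show ?thesis by (rule order_trans)
  next
    case On_Demand_Only
    with that(1) have "feasible V \<Lambda> \<mu>\<^sub>s \<mu>\<^sub>o K On_Demand_Only y" by (simp only:)
    from profit_on_demand_le[OF this] adm show ?thesis by (blast intro: order_trans)
  next
    case Two_Services
    with that(1) have "feasible V \<Lambda> \<mu>\<^sub>s \<mu>\<^sub>o K Two_Services y" by (simp only:)
    from profit_two_le[OF this] adm show ?thesis by (blast intro: order_trans)
  qed
  show ?thesis
  \<comment> \<open>The strict gain is what keeps \<open>l\<^sub>o\<close> away from 0, so the
    compactness argument is reserved for that case; otherwise the standard service is
    optimal.\<close>
  proof (cases "\<exists>l m k. admissible l m k \<and> ?P < best l m k")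
    case False
    obtain x where x: "feasible V \<Lambda> \<mu>\<^sub>s \<mu>\<^sub>o K Standard_Only x" "profit w\<^sub>s x = ?P"
      using profit_standard_attained by blast
    have "best l m k \<le> ?P" if "admissible l m k" for l m k
      using False that not_less by blast
    then have "profit w\<^sub>s y \<le> profit w\<^sub>s x" if "feasible V \<Lambda> \<mu>\<^sub>s \<mu>\<^sub>o K d y" for d y
      unfolding x(2) using bound[OF that order_refl] by blast
    then show ?thesis unfolding optimal_deployment_def using x(1) by blast
  next
    case True
    then obtain l0 m0 k0 where 0: "admissible l0 m0 k0" "?P < best l0 m0 k0" by blast
    then obtain l m k where a: "admissible l m k"
      and mx: "\<And>l' m' k'. admissible l' m' k' \<Longrightarrow> best l' m' k' \<le> best l m k"
      using best_has_maximum by blast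
    have P: "?P \<le> best l m k" using mx[OF 0(1)] 0(2) by linarith
    obtain d x where x: "feasible V \<Lambda> \<mu>\<^sub>s \<mu>\<^sub>o K d x" "profit w\<^sub>s x = best l m k"
    proof (cases "l = 0")
      case True
      then show ?thesis using best_attained_on_demand[of m k] a that by blast
    next
      case False
      then have "l > 0" using a by (simp add: admissible_def)
      then show ?thesis using best_attained_two[OF a] that by blast
    qed
    have "profit w\<^sub>s y \<le> profit w\<^sub>s x" if "feasible V \<Lambda> \<mu>\<^sub>s \<mu>\<^sub>o K d' y" for d' y
      unfolding x(2) using bound[OF that P mx] .
    then show ?thesis unfolding optimal_deployment_def using x(1) by blast
  qed
qed

end

theorem theorem3:
  fixes V \<Lambda> \<mu>\<^sub>s \<mu>\<^sub>o :: real
  assumes "V > 0" and "\<Lambda> > 0" and "\<mu>\<^sub>s > 0" and "\<mu>\<^sub>o > 0"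
  shows "\<exists>R\<^sub>S R\<^sub>O R\<^sub>H :: (real \<times> real) set.
    R\<^sub>S \<union> R\<^sub>O \<union> R\<^sub>H = feasible_space V \<Lambda> \<mu>\<^sub>s \<and>
    R\<^sub>S \<inter> R\<^sub>O = {} \<and> R\<^sub>S \<inter> R\<^sub>H = {} \<and> R\<^sub>O \<inter> R\<^sub>H = {} \<and>
    (\<forall>(w\<^sub>s, K) \<in> R\<^sub>S. optimal_deployment V \<Lambda> \<mu>\<^sub>s \<mu>\<^sub>o w\<^sub>s K Standard_Only) \<and>
    (\<forall>(w\<^sub>s, K) \<in> R\<^sub>O. optimal_deployment V \<Lambda> \<mu>\<^sub>s \<mu>\<^sub>o w\<^sub>s K On_Demand_Only) \<and>
    (\<forall>(w\<^sub>s, K) \<in> R\<^sub>H. optimal_deployment V \<Lambda> \<mu>\<^sub>s \<mu>\<^sub>o w\<^sub>s K Two_Services)"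
proof -
  let ?opt = "\<lambda>d. {(w, K). optimal_deployment V \<Lambda> \<mu>\<^sub>s \<mu>\<^sub>o w K d}"
  \<comment> \<open>Ties between deployments are broken in the order standard, on-demand, two
    services, which makes the regimes disjoint.\<close>
  define R\<^sub>S where "R\<^sub>S = feasible_space V \<Lambda> \<mu>\<^sub>s \<inter> ?opt Standard_Only"
  define R\<^sub>O where "R\<^sub>O = feasible_space V \<Lambda> \<mu>\<^sub>s \<inter> ?opt On_Demand_Only - R\<^sub>S"
  define R\<^sub>H where "R\<^sub>H = feasible_space V \<Lambda> \<mu>\<^sub>s - R\<^sub>S - R\<^sub>O"
  \<comment> \<open>On \<open>R\<^sub>H\<close> neither single service is optimal, so the optimal
    deployment that exists must be the third.\<close>
  have two: "optimal_deployment V \<Lambda> \<mu>\<^sub>s \<mu>\<^sub>o w K Two_Services" if wK: "(w, K) \<in> R\<^sub>H" for w K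
  proof -
    have "(w, K) \<in> feasible_space V \<Lambda> \<mu>\<^sub>s" using wK by (simp add: R\<^sub>H_def)
    then interpret market V \<Lambda> \<mu>\<^sub>s \<mu>\<^sub>o w K
      using assms by unfold_locales (auto simp: feasible_space_def)
    obtain d where "optimal_deployment V \<Lambda> \<mu>\<^sub>s \<mu>\<^sub>o w K d" using optimal_deployment_exists by blast
    then show ?thesis using wK by (cases d) (auto simp: R\<^sub>H_def R\<^sub>O_def R\<^sub>S_def)
  qed
  show ?thesis
    by (rule exI[of _ R\<^sub>S], rule exI[of _ R\<^sub>O], rule exI[of _ R\<^sub>H])
      (use two in \<open>auto simp: R\<^sub>S_def R\<^sub>O_def R\<^sub>H_def\<close>)
qed

end
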